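(* Let $X$ and $Y$ be infinite-dimensional Banach spaces, and suppose that $Y$ contains an isomorphic copy of $\ell^\infty$. Then $K(X,Y)$ contains a complemented copy of $c_0$.
   Context: $K(X,Y)$ denotes the Banach space, with the operator norm, of compact linear operators from $X$ to $Y$. A Banach space $E$ contains an isomorphic copy of a Banach space $F$ if $E$ has a closed subspace that is linearly homeomorphic to $F$; it contains a complemented copy of $F$ if it has such a subspace which is moreover the range of a continuous linear projection defined on $E$. *)

theory Defs
  imports "HOL-Analysis.Analysis"
begin

(* Scalars are real, as in the library class banach. *)

definition infinite_dimensional :: "'a::real_vector set \<Rightarrow> bool" where
  "infinite_dimensional V \<longleftrightarrow> \<not> (\<exists>B. finite B \<and> B \<subseteq> V \<and> V \<subseteq> span B)"

(* Continuity is automatic for a compact operator, so taking bounded linear maps as the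
   ambient type loses nothing; the norm of this type is the operator norm. *)
definition compact_operators :: "('a::real_normed_vector \<Rightarrow>\<^sub>L 'b::real_normed_vector) set" where
  "compact_operators = {T. compact (closure (blinfun_apply T ` cball 0 1))}"

(* Every function on the discrete space nat is continuous, so the type of bounded continuous
   functions on nat, with its supremum norm, is the space of bounded sequences. *)
definition l_infinity :: "(nat \<Rightarrow>\<^sub>C real) set" where
  "l_infinity = UNIV"

definition c_zero :: "(nat \<Rightarrow>\<^sub>C real) set" where
  "c_zero = {f. apply_bcontfun f \<longlonglongrightarrow> 0}"

(* The library predicate linear applies to total maps only. *)
definition linear_map_on :: "'a::real_vector set \<Rightarrow> ('a \<Rightarrow> 'b::real_vector) \<Rightarrow> bool" where
  "linear_map_on V f \<longleftrightarrow>
     (\<forall>x\<in>V. \<forall>y\<in>V. f (x + y) = f x + f y) \<and> (\<forall>c. \<forall>x\<in>V. f (c *\<^sub>R x) = c *\<^sub>R f x)"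

definition linearly_homeomorphic ::
    "'a::real_normed_vector set \<Rightarrow> 'b::real_normed_vector set \<Rightarrow> bool" where
  "linearly_homeomorphic V W \<longleftrightarrow> (\<exists>f g. linear_map_on V f \<and> homeomorphism V W f g)"

definition isomorphic_copy_in ::
    "'a::real_normed_vector set \<Rightarrow> 'b::real_normed_vector set \<Rightarrow> 'a set \<Rightarrow> bool" where
  "isomorphic_copy_in E F G \<longleftrightarrow>
     subspace G \<and> G \<subseteq> E \<and> closedin (top_of_set E) G \<and> linearly_homeomorphic G F"

definition contains_copy ::
    "'a::real_normed_vector set \<Rightarrow> 'b::real_normed_vector set \<Rightarrow> bool" where
  "contains_copy E F \<longleftrightarrow> (\<exists>G. isomorphic_copy_in E F G)"

definition continuous_projection_onto ::
    "'a::real_normed_vector set \<Rightarrow> 'a set \<Rightarrow> ('a \<Rightarrow> 'a) \<Rightarrow> bool" where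
  "continuous_projection_onto E G P \<longleftrightarrow>
     linear_map_on E P \<and> continuous_on E P \<and> P ` E = G \<and> (\<forall>x\<in>E. P (P x) = P x)"

definition contains_complemented_copy ::
    "'a::real_normed_vector set \<Rightarrow> 'b::real_normed_vector set \<Rightarrow> bool" where
  "contains_complemented_copy E F \<longleftrightarrow>
     (\<exists>G. isomorphic_copy_in E F G \<and> (\<exists>P. continuous_projection_onto E G P))"

end

theory Submission
  imports Defs
begin

text \<open>
  Since a copy of \<open>\<ell>\<^sup>\<infinity>\<close> in \<open>Y\<close> is given by a bounded map \<open>J : \<ell>\<^sup>\<infinity> \<rightarrow> Y\<close> whose coordinate functionals
  extend by Hahn-Banach to uniformly bounded \<open>\<psi>\<^sub>t \<in> Y\<^sup>*\<close>, operators from \<open>X\<close> to \<open>Y\<close> can be built and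
  tested coordinate by coordinate. Only one property of \<open>X\<close> enters, the finite form of the
  Dvoretzky-Rogers theorem: if \<open>X\<close> is infinite-dimensional, then for every \<open>k\<close> there are vectors
  \<open>x\<^sub>k\<^sub>i\<close>, \<open>i < n\<^sub>k\<close>, with \<open>\<Sum>\<^sub>i \<parallel>x\<^sub>k\<^sub>i\<parallel> = 1\<close> but \<open>\<Sum>\<^sub>i \<bar>z(x\<^sub>k\<^sub>i)\<bar> \<le> \<parallel>z\<parallel> / (k + 1)\<close> for all \<open>z \<in> X\<^sup>*\<close>.

  Split the coordinates of \<open>\<ell>\<^sup>\<infinity>\<close> into blocks, the \<open>k\<close>-th one of length \<open>n\<^sub>k\<close>, and let \<open>z\<^sub>k\<^sub>i\<close> be a
  functional of norm at most one with \<open>z\<^sub>k\<^sub>i(x\<^sub>k\<^sub>i) = \<parallel>x\<^sub>k\<^sub>i\<parallel>\<close>. For a sequence \<open>a\<close> let \<open>S a\<close> send \<open>v\<close> to the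
  image under \<open>J\<close> of the sequence with entry \<open>a\<^sub>k z\<^sub>k\<^sub>i(v)\<close> at position \<open>(k, i)\<close>, and for an operator
  \<open>T\<close> let \<open>(\<Phi> T)\<^sub>k = \<Sum>\<^sub>i \<psi>\<^sub>k\<^sub>i(T x\<^sub>k\<^sub>i)\<close>. Both maps are bounded and \<open>\<Phi> (S a) = a\<close>, because
  \<open>\<Sum>\<^sub>i z\<^sub>k\<^sub>i(x\<^sub>k\<^sub>i) = 1\<close>. If \<open>a \<in> c\<^sub>0\<close>, then \<open>S a\<close> maps the unit ball into the image of a box with sides
  tending to zero, which is compact (\<open>compact_null_box\<close>). If \<open>T\<close> is compact, the functionals
  \<open>\<psi>\<^sub>t \<circ> T\<close> form a totally bounded subset of \<open>X\<^sup>*\<close> (\<open>compact_adjoint_net\<close>), so up to a small error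
  only finitely many functionals \<open>z\<close> occur in \<open>(\<Phi> T)\<^sub>k\<close>, and each of them contributes at most
  \<open>\<parallel>z\<parallel> / (k + 1)\<close>; hence \<open>\<Phi> T \<in> c\<^sub>0\<close>. Thus \<open>S \<circ> \<Phi>\<close> projects the compact operators onto the copy
  \<open>S(c\<^sub>0)\<close> of \<open>c\<^sub>0\<close>.

  The Dvoretzky-Rogers theorem is proved by contradiction. If it failed, the identity of \<open>X\<close> would be absolutely summing, hence 2-summing. A Pietsch-type
  domination argument then yields an inner product on \<open>X\<close> equivalent to the norm
  (\<open>pietsch_inner_product\<close>), and \<open>n\<close> orthonormal vectors for a large \<open>n\<close> contradict summability: their
  norms add up to at least \<open>n\<close>, while all sums of them with signs have norm of order \<open>\<surd>n\<close>.
\<close>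

section \<open>The Hahn-Banach theorem\<close>

text \<open>
  Partial linear functionals dominated by \<open>p\<close> are represented by their graphs, which are linear
  subspaces of the product with \<open>\<real>\<close>. Single-valuedness is automatic: if \<open>(0, r)\<close> lies in such a
  subspace, then so does \<open>(0, - r)\<close>, and both \<open>r\<close> and \<open>- r\<close> are at most \<open>p 0 = 0\<close>. Zorn's lemma
  applied to these graphs gives a maximal one, and a maximal graph is total because any missing
  vector can be adjoined.
\<close>
theorem hahn_banach:
  fixes p f :: "'v::real_vector \<Rightarrow> real"
  assumes sub: "\<And>x y. p (x + y) \<le> p x + p y"
    and hom: "\<And>t x. t \<ge> 0 \<Longrightarrow> p (t *\<^sub>R x) = t * p x"
    and F: "subspace F" and lin: "linear_map_on F f"
    and le: "\<And>x. x \<in> F \<Longrightarrow> f x \<le> p x"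
  shows "\<exists>g. linear g \<and> (\<forall>x\<in>F. g x = f x) \<and> (\<forall>x. g x \<le> p x)"
proof -
  define \<G> where "\<G> = {G :: ('v \<times> real) set. subspace G \<and> (\<lambda>x. (x, f x)) ` F \<subseteq> G \<and> (\<forall>(x, r)\<in>G. r \<le> p x)}"
  have f0: "f 0 = 0"
    using lin subspace_0[OF F] unfolding linear_map_on_def by (metis scaleR_zero_left)
  have base: "(\<lambda>x. (x, f x)) ` F \<in> \<G>"
  proof -
    have "subspace ((\<lambda>x. (x, f x)) ` F)"
      unfolding subspace_def
    proof (intro conjI ballI allI)
      show "0 \<in> (\<lambda>x. (x, f x)) ` F"
        using f0 subspace_0[OF F] by (force simp: zero_prod_def)
    next
      fix u v assume "u \<in> (\<lambda>x. (x, f x)) ` F" "v \<in> (\<lambda>x. (x, f x)) ` F"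
      then obtain x y where xy: "x \<in> F" "y \<in> F" "u = (x, f x)" "v = (y, f y)" by auto
      then have "u + v = (x + y, f (x + y))" "x + y \<in> F"
        using lin subspace_add[OF F] unfolding linear_map_on_def by auto
      then show "u + v \<in> (\<lambda>x. (x, f x)) ` F" by auto
    next
      fix c u assume "u \<in> (\<lambda>x. (x, f x)) ` F"
      then obtain x where x: "x \<in> F" "u = (x, f x)" by auto
      then have "c *\<^sub>R u = (c *\<^sub>R x, f (c *\<^sub>R x))" "c *\<^sub>R x \<in> F"
        using lin subspace_scale[OF F] unfolding linear_map_on_def by auto
      then show "c *\<^sub>R u \<in> (\<lambda>x. (x, f x)) ` F" by auto
    qed
    then show ?thesis using le by (auto simp: \<G>_def)
  qed
  have chain: "\<Union>\<C> \<in> \<G>" if "\<C> \<noteq> {}" "subset.chain \<G> \<C>" for \<C>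
  proof -
    have CG: "\<And>G. G \<in> \<C> \<Longrightarrow> G \<in> \<G>" and tot: "\<And>G H. G \<in> \<C> \<Longrightarrow> H \<in> \<C> \<Longrightarrow> G \<subseteq> H \<or> H \<subseteq> G"
      using that(2) unfolding subset_chain_def by blast+
    have "subspace (\<Union>\<C>)"
      unfolding subspace_def
    proof (intro conjI ballI allI)
      show "0 \<in> \<Union>\<C>" using that(1) CG unfolding \<G>_def using subspace_0 by blast
    next
      fix u v assume "u \<in> \<Union>\<C>" "v \<in> \<Union>\<C>"
      then obtain G where "G \<in> \<C>" "u \<in> G" "v \<in> G" using tot by blast
      then show "u + v \<in> \<Union>\<C>" using CG subspace_add unfolding \<G>_def by blast
    next
      fix c u assume "u \<in> \<Union>\<C>"
      then show "c *\<^sub>R u \<in> \<Union>\<C>" using CG subspace_scale unfolding \<G>_def by blast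
    qed
    then show ?thesis using that(1) CG unfolding \<G>_def by blast
  qed
  obtain M where M: "M \<in> \<G>" and max: "\<And>G. G \<in> \<G> \<Longrightarrow> M \<subseteq> G \<Longrightarrow> G = M"
    using subset_Zorn_nonempty[of \<G>, OF _ chain] base by blast
  have Ms: "subspace M" and Mf: "\<And>x. x \<in> F \<Longrightarrow> (x, f x) \<in> M" and Mp: "\<And>x r. (x, r) \<in> M \<Longrightarrow> r \<le> p x"
    using M unfolding \<G>_def by auto
  have p0: "p 0 = 0" using hom[of 0 0] by simp
  have uniq: "r = s" if "(x, r) \<in> M" "(x, s) \<in> M" for x r s
    using Mp[of 0 "r - s"] Mp[of 0 "s - r"] subspace_diff[OF Ms that] subspace_diff[OF Ms that(2,1)] p0
    by simp
  have total: "\<exists>r. (x0, r) \<in> M" for x0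
  proof -
    define A where "A = (\<lambda>(x, r). r - p (x - x0)) ` M"
    have M0: "(0, 0) \<in> M" using subspace_0[OF Ms] by (simp add: zero_prod_def)
    have key: "r - p (x - x0) \<le> p (y + x0) - s" if "(x, r) \<in> M" "(y, s) \<in> M" for x r y s
      using Mp[of "x + y" "r + s"] subspace_add[OF Ms that] sub[of "x - x0" "y + x0"] by simp
    have An: "A \<noteq> {}" using M0 by (auto simp: A_def)
    have Ab: "bdd_above A" using key[OF _ M0] by (intro bdd_aboveI[of _ "p x0"]) (auto simp: A_def)
    \<comment> \<open>Any value between the two sides of \<open>key\<close> may be assigned to \<open>x0\<close>.\<close>
    define c where "c = Sup A"
    have c1: "r - p (x - x0) \<le> c" if "(x, r) \<in> M" for x r
      unfolding c_def by (rule cSup_upper[OF _ Ab]) (use that in \<open>force simp: A_def\<close>)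
    have c2: "c \<le> p (y + x0) - s" if "(y, s) \<in> M" for y s
      unfolding c_def by (rule cSup_least[OF An]) (use that key in \<open>auto simp: A_def\<close>)
    define G where "G = {m + t *\<^sub>R (x0, c) |m t. m \<in> M}"
    have "r + t * c \<le> p (x + t *\<^sub>R x0)" if m: "(x, r) \<in> M" for x r t
    proof (cases t "0::real" rule: linorder_cases)
      case equal then show ?thesis using Mp[OF m] by simp
    next
      case greater
      have "(1/t) *\<^sub>R (x, r) \<in> M" using subspace_scale[OF Ms m] .
      then have "c \<le> p ((1/t) *\<^sub>R x + x0) - (1/t) * r" using c2 by simp
      then have "t * c \<le> t * (p ((1/t) *\<^sub>R x + x0) - (1/t) * r)" using greater by simp
      also have "\<dots> = p (x + t *\<^sub>R x0) - r"
        using greater hom[of t "(1/t) *\<^sub>R x + x0"] by (simp add: algebra_simps)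
      finally show ?thesis by simp
    next
      case less
      define u where "u = - t"
      have u: "u > 0" "t = - u" using less by (auto simp: u_def)
      have "(1/u) *\<^sub>R (x, r) \<in> M" using subspace_scale[OF Ms m] .
      then have "(1/u) * r - p ((1/u) *\<^sub>R x - x0) \<le> c" using c1 by simp
      then have "u * ((1/u) * r - p ((1/u) *\<^sub>R x - x0)) \<le> u * c" using u by simp
      moreover have "u * ((1/u) * r - p ((1/u) *\<^sub>R x - x0)) = r - p (x + t *\<^sub>R x0)"
        using u hom[of u "(1/u) *\<^sub>R x - x0"] by (simp add: algebra_simps)
      ultimately have "r - p (x + t *\<^sub>R x0) \<le> u * c" by linarith
      then show ?thesis unfolding u(2) by simp
    qed
    then have Gp: "\<forall>(x, r)\<in>G. r \<le> p x" by (auto simp: G_def)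
    have MG: "M \<subseteq> G" unfolding G_def by (force intro: exI[of _ 0])
    have "subspace G"
      unfolding subspace_def
    proof (intro conjI ballI allI)
      show "0 \<in> G" using MG subspace_0[OF Ms] by blast
    next
      fix u v assume "u \<in> G" "v \<in> G"
      then obtain m t n s where "m \<in> M" "n \<in> M" "u = m + t *\<^sub>R (x0, c)" "v = n + s *\<^sub>R (x0, c)"
        unfolding G_def by blast
      moreover from this have "u + v = (m + n) + (t + s) *\<^sub>R (x0, c)" by (simp only: scaleR_left_distrib ac_simps)
      ultimately show "u + v \<in> G" unfolding G_def using subspace_add[OF Ms] by blast
    next
      fix k u assume "u \<in> G"
      then obtain m t where "m \<in> M" "u = m + t *\<^sub>R (x0, c)" unfolding G_def by blast
      moreover from this have "k *\<^sub>R u = k *\<^sub>R m + (k * t) *\<^sub>R (x0, c)"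
        by (simp only: scaleR_right_distrib scaleR_scaleR)
      ultimately show "k *\<^sub>R u \<in> G" unfolding G_def using subspace_scale[OF Ms] by blast
    qed
    then have "G = M" using max[OF _ MG] Gp MG Mf unfolding \<G>_def by blast
    moreover have "0 + 1 *\<^sub>R (x0, c) \<in> G" unfolding G_def using subspace_0[OF Ms] by blast
    ultimately show ?thesis by auto
  qed
  define g where "g x = (THE r. (x, r) \<in> M)" for x
  have gM: "(x, g x) \<in> M" for x
    unfolding g_def by (rule theI') (use total uniq in blast)
  have geq: "g x = r" if "(x, r) \<in> M" for x r using uniq[OF gM that] .
  have "linear g"
  proof (rule linearI)
    show "g (x + y) = g x + g y" for x y
      using subspace_add[OF Ms gM[of x] gM[of y]] geq by simp
    show "g (c *\<^sub>R x) = c *\<^sub>R g x" for c x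
      using subspace_scale[OF Ms gM[of x], of c] geq by simp
  qed
  then show ?thesis using geq Mf Mp[OF gM] by blast
qed

lemma bounded_functional_extension:
  fixes F :: "'v::real_normed_vector set"
  assumes F: "subspace F" and lin: "linear_map_on F f"
    and le: "\<And>x. x \<in> F \<Longrightarrow> \<bar>f x\<bar> \<le> M * norm x" and M: "M \<ge> 0"
  shows "\<exists>z :: 'v \<Rightarrow>\<^sub>L real. (\<forall>x\<in>F. blinfun_apply z x = f x) \<and> norm z \<le> M"
proof -
  obtain g where g: "linear g" "\<forall>x\<in>F. g x = f x" "\<forall>x. g x \<le> M * norm x"
    using hahn_banach[of "\<lambda>x. M * norm x", OF _ _ F lin] le M
    by (smt (verit) abs_le_D1 norm_scaleR norm_triangle_ineq mult_left_mono distrib_left mult.left_commute)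
  have b: "\<bar>g x\<bar> \<le> M * norm x" for x
    using g(3)[rule_format, of x] g(3)[rule_format, of "-x"] linear_neg[OF g(1)] by auto
  have bl: "bounded_linear g"
    using g(1) b by (intro bounded_linear_intro[where K=M])
      (auto simp: linear_add linear_scale mult.commute)
  have "norm (Blinfun g) \<le> M"
    using b M by (intro norm_blinfun_bound) (auto simp: bounded_linear_Blinfun_apply[OF bl])
  then show ?thesis using g(2) by (intro exI[of _ "Blinfun g"]) (simp add: bounded_linear_Blinfun_apply[OF bl])
qed

lemma norming_functional:
  fixes x :: "'v::real_normed_vector"
  shows "\<exists>z :: 'v \<Rightarrow>\<^sub>L real. norm z \<le> 1 \<and> blinfun_apply z x = norm x"
proof (cases "x = 0")
  case True
  then show ?thesis by (intro exI[of _ 0]) auto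
next
  case False
  define f where "f v = (THE t. v = t *\<^sub>R x) * norm x" for v
  have f: "f (t *\<^sub>R x) = t * norm x" for t using False by (simp add: f_def)
  have S: "v \<in> span {x} \<longleftrightarrow> (\<exists>t. v = t *\<^sub>R x)" for v by (auto simp: span_singleton)
  have "linear_map_on (span {x}) f"
    unfolding linear_map_on_def
  proof (intro conjI ballI allI)
    fix u v assume "u \<in> span {x}" "v \<in> span {x}"
    then show "f (u + v) = f u + f v" unfolding S by (metis f scaleR_left_distrib distrib_right)
  next
    fix c u assume "u \<in> span {x}"
    then show "f (c *\<^sub>R u) = c *\<^sub>R f u" unfolding S by (auto simp: f)
  qed
  moreover have "\<bar>f v\<bar> \<le> 1 * norm v" if "v \<in> span {x}" for v
    using that unfolding S by (auto simp: f abs_mult)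
  ultimately obtain z :: "'v \<Rightarrow>\<^sub>L real" where "\<forall>v\<in>span {x}. blinfun_apply z v = f v" "norm z \<le> 1"
    using bounded_functional_extension[of "span {x}" f 1] by auto
  then show ?thesis using f[of 1] by (auto intro!: exI[of _ z] simp: span_base)
qed

section \<open>The Dvoretzky-Rogers theorem\<close>

text \<open>
  The diagonal \<open>z \<mapsto> B z z\<close> of this bilinear form on the dual space is the product of the two
  evaluations at \<open>x\<close> and \<open>y\<close>. Bounded bilinear forms serve as a normed space that contains all
  functions \<open>z \<mapsto> (z x)\<^sup>2\<close> on which a Pietsch measure has to act.
\<close>
definition tensor_form :: "'a::real_normed_vector \<Rightarrow> 'a \<Rightarrow> ('a \<Rightarrow>\<^sub>L real) \<Rightarrow>\<^sub>L ('a \<Rightarrow>\<^sub>L real) \<Rightarrow>\<^sub>L real" where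
  "tensor_form x y = Blinfun (\<lambda>z. blinfun_apply z x *\<^sub>R Blinfun (\<lambda>w. blinfun_apply w y))"

lemma tensor_form_apply [simp]:
  "blinfun_apply (blinfun_apply (tensor_form x y) z) w = blinfun_apply z x * blinfun_apply w y"
proof -
  have 1: "bounded_linear (\<lambda>w :: 'a \<Rightarrow>\<^sub>L real. blinfun_apply w y)" for y :: 'a
    by (rule blinfun.bounded_linear_left)
  have 2: "bounded_linear (\<lambda>z. blinfun_apply z x *\<^sub>R Blinfun (\<lambda>w. blinfun_apply w y))"
    by (intro bounded_linear_scaleR_const 1)
  show ?thesis
    unfolding tensor_form_def bounded_linear_Blinfun_apply[OF 2]
    by (simp add: bounded_linear_Blinfun_apply[OF 1] blinfun.scaleR_left)
qed

text \<open>
  This is Pietsch's domination theorem for 2-summing maps, with the dominating measure on the dual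
  ball replaced by a linear functional \<open>L\<close> on bilinear forms. The sublinear functional \<open>p\<close> below is
  at most the supremum of \<open>B z z\<close> over the unit ball, which bounds \<open>L\<close> from above on the squares
  \<open>z \<mapsto> (z x)\<^sup>2\<close>, and the families \<open>xs\<close> in its definition force \<open>p (- K (z x)\<^sup>2) \<le> - \<parallel>x\<parallel>\<^sup>2\<close>, which
  bounds \<open>L\<close> from below on them. The hypothesis that the identity is 2-summing ensures that
  \<open>p\<close> does not take the value \<open>- \<infinity>\<close>. Since \<open>p\<close> depends on the diagonal only, so does \<open>L\<close>, which
  makes the resulting form symmetric.
\<close>
lemma pietsch_inner_product:
  fixes K :: real
  assumes K0: "K > 0" and summing: "\<And>(xs :: 'a::real_normed_vector list) w. w \<ge> 0 \<Longrightarrow>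
      (\<And>z :: 'a \<Rightarrow>\<^sub>L real. (\<Sum>x\<leftarrow>xs. (blinfun_apply z x)\<^sup>2) \<le> w * (norm z)\<^sup>2) \<Longrightarrow>
      (\<Sum>x\<leftarrow>xs. (norm x)\<^sup>2) \<le> K * w"
  shows "\<exists>b :: 'a \<Rightarrow> 'a \<Rightarrow> real. (\<forall>x. linear (b x)) \<and> (\<forall>x y. b x y = b y x) \<and>
    (\<forall>x. b x x \<le> (norm x)\<^sup>2) \<and> (\<forall>x. (norm x)\<^sup>2 \<le> K * b x x)"
proof -
  define A where "A B = {r - (\<Sum>x\<leftarrow>xs. (norm x)\<^sup>2) | r (xs :: 'a list).
     \<forall>z. norm z \<le> 1 \<longrightarrow> blinfun_apply (blinfun_apply B z) z + K * (\<Sum>x\<leftarrow>xs. (blinfun_apply z x)\<^sup>2) \<le> r}"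
    for B :: "('a \<Rightarrow>\<^sub>L real) \<Rightarrow>\<^sub>L ('a \<Rightarrow>\<^sub>L real) \<Rightarrow>\<^sub>L real"
  define p where "p B = Inf (A B)" for B
  have AI: "r - (\<Sum>x\<leftarrow>xs. (norm x)\<^sup>2) \<in> A B"
    if "\<And>z. norm z \<le> 1 \<Longrightarrow> blinfun_apply (blinfun_apply B z) z + K * (\<Sum>x\<leftarrow>xs. (blinfun_apply z x)\<^sup>2) \<le> r" for B r xs
    using that unfolding A_def by blast
  have AE: "\<exists>r (xs :: 'a list). a = r - (\<Sum>x\<leftarrow>xs. (norm x)\<^sup>2) \<and> (\<forall>z. norm z \<le> 1 \<longrightarrow>
      blinfun_apply (blinfun_apply B z) z + K * (\<Sum>x\<leftarrow>xs. (blinfun_apply z x)\<^sup>2) \<le> r)" if "a \<in> A B" for a B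
    using that by (simp add: A_def)
  have diag: "\<bar>blinfun_apply (blinfun_apply B z) z\<bar> \<le> norm B" if "norm z \<le> 1"
    for B :: "('a \<Rightarrow>\<^sub>L real) \<Rightarrow>\<^sub>L ('a \<Rightarrow>\<^sub>L real) \<Rightarrow>\<^sub>L real" and z
  proof -
    have "norm (blinfun_apply (blinfun_apply B z) z) \<le> norm (blinfun_apply B z) * norm z"
      by (rule norm_blinfun)
    also have "\<dots> \<le> (norm B * norm z) * norm z"
      by (intro mult_right_mono norm_blinfun) auto
    also have "\<dots> \<le> (norm B * 1) * 1"
      using that by (intro mult_mono) auto
    finally show ?thesis by simp
  qed
  have lower: "- norm B \<le> a" if aA: "a \<in> A B" for a B
  proof -
    obtain r xs where a: "a = r - (\<Sum>x\<leftarrow>xs. (norm x)\<^sup>2)" and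
      r: "\<forall>z. norm z \<le> 1 \<longrightarrow> blinfun_apply (blinfun_apply B z) z + K * (\<Sum>x\<leftarrow>xs. (blinfun_apply z x)\<^sup>2) \<le> r"
      using AE[OF aA] by blast
    have r': "K * (\<Sum>x\<leftarrow>xs. (blinfun_apply z x)\<^sup>2) \<le> r + norm B" if "norm z \<le> 1" for z
      using r[rule_format, OF that] diag[OF that, of B] by linarith
    have rB: "r + norm B \<ge> 0" using r'[of 0] by (simp add: blinfun.zero_left flip: sum_list_mult_const)
      have "(\<Sum>x\<leftarrow>xs. (norm x)\<^sup>2) \<le> K * ((r + norm B) / K)"
      proof (rule summing)
        show "0 \<le> (r + norm B) / K" using rB K0 by simp
        fix z :: "'a \<Rightarrow>\<^sub>L real"
        show "(\<Sum>x\<leftarrow>xs. (blinfun_apply z x)\<^sup>2) \<le> (r + norm B) / K * (norm z)\<^sup>2"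
        proof (cases "z = 0")
          case True
          then show ?thesis by (simp add: blinfun.zero_left flip: sum_list_mult_const)
        next
          case False
          define u where "u = (1 / norm z) *\<^sub>R z"
          have u: "norm u \<le> 1" "z = norm z *\<^sub>R u" using False by (auto simp: u_def)
          have "(\<Sum>x\<leftarrow>xs. (blinfun_apply z x)\<^sup>2) = (\<Sum>x\<leftarrow>xs. (blinfun_apply u x)\<^sup>2) * (norm z)\<^sup>2"
            by (subst u(2)) (simp add: blinfun.scaleR_left power_mult_distrib mult.commute sum_list_const_mult)
          also have "\<dots> \<le> (r + norm B) / K * (norm z)\<^sup>2"
            using r'[OF u(1)] K0 by (intro mult_right_mono) (auto simp: pos_le_divide_eq mult.commute)
          finally show ?thesis .
        qed
      qed
      then show ?thesis using a K0 by simp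
  qed
  have Abdd: "bdd_below (A B)" for B using lower by (intro bdd_belowI) auto
  have Ane: "A B \<noteq> {}" for B
    using AI[of B "[]" "norm B"] diag[of _ B] by (fastforce dest: abs_le_D1)
  have p_le: "p B \<le> a" if "a \<in> A B" for a B
    unfolding p_def using that Abdd by (rule cInf_lower)
  have sub: "p (B + C) \<le> p B + p C" for B C
  proof (rule field_le_epsilon)
    fix e :: real assume e: "e > 0"
    obtain a where a: "a \<in> A B" "a < p B + e/2"
      using cInf_lessD[OF Ane, of B "p B + e/2"] e unfolding p_def by auto
    obtain c where c: "c \<in> A C" "c < p C + e/2"
      using cInf_lessD[OF Ane, of C "p C + e/2"] e unfolding p_def by auto
    obtain r xs where r: "a = r - (\<Sum>x\<leftarrow>xs. (norm x)\<^sup>2)"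
      "\<forall>z. norm z \<le> 1 \<longrightarrow> blinfun_apply (blinfun_apply B z) z + K * (\<Sum>x\<leftarrow>xs. (blinfun_apply z x)\<^sup>2) \<le> r"
      using AE[OF a(1)] by blast
    obtain s ys where s: "c = s - (\<Sum>x\<leftarrow>ys. (norm x)\<^sup>2)"
      "\<forall>z. norm z \<le> 1 \<longrightarrow> blinfun_apply (blinfun_apply C z) z + K * (\<Sum>x\<leftarrow>ys. (blinfun_apply z x)\<^sup>2) \<le> s"
      using AE[OF c(1)] by blast
    have "(r + s) - (\<Sum>x\<leftarrow>xs @ ys. (norm x)\<^sup>2) \<in> A (B + C)"
    proof (rule AI)
      fix z :: "'a \<Rightarrow>\<^sub>L real" assume z: "norm z \<le> 1"
      show "blinfun_apply (blinfun_apply (B + C) z) z + K * (\<Sum>x\<leftarrow>xs @ ys. (blinfun_apply z x)\<^sup>2) \<le> r + s"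
        using r(2)[rule_format, OF z] s(2)[rule_format, OF z] by (simp add: blinfun.add_left distrib_left)
    qed
    from p_le[OF this] show "p (B + C) \<le> p B + p C + e" using a(2) c(2) r(1) s(1) by simp
  qed
  have p0: "p 0 = 0"
  proof (rule antisym)
    show "p 0 \<le> 0" using p_le[OF AI[of 0 "[]" 0]] by (simp add: blinfun.zero_left)
    show "0 \<le> p 0" unfolding p_def by (rule cInf_greatest[OF Ane]) (use lower[of _ 0] in auto)
  qed
  have hom1: "p (t *\<^sub>R B) \<le> t * p B" if t: "t > 0" for t B
  proof (rule field_le_epsilon)
    fix e :: real assume e: "e > 0"
    obtain a where a: "a \<in> A B" "a < p B + e/t"
      using cInf_lessD[OF Ane, of B "p B + e/t"] e t unfolding p_def by auto
    obtain r xs where r: "a = r - (\<Sum>x\<leftarrow>xs. (norm x)\<^sup>2)"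
      "\<forall>z. norm z \<le> 1 \<longrightarrow> blinfun_apply (blinfun_apply B z) z + K * (\<Sum>x\<leftarrow>xs. (blinfun_apply z x)\<^sup>2) \<le> r"
      using AE[OF a(1)] by blast
    let ?ys = "map (\<lambda>x. sqrt t *\<^sub>R x) xs"
    have ys: "(\<Sum>x\<leftarrow>?ys. (norm x)\<^sup>2) = t * (\<Sum>x\<leftarrow>xs. (norm x)\<^sup>2)"
      "(\<Sum>x\<leftarrow>?ys. (blinfun_apply z x)\<^sup>2) = t * (\<Sum>x\<leftarrow>xs. (blinfun_apply z x)\<^sup>2)" for z :: "'a \<Rightarrow>\<^sub>L real"
      using t by (simp_all add: o_def power_mult_distrib blinfun.scaleR_right sum_list_const_mult)
    have "t * r - (\<Sum>x\<leftarrow>?ys. (norm x)\<^sup>2) \<in> A (t *\<^sub>R B)"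
    proof (rule AI)
      fix z :: "'a \<Rightarrow>\<^sub>L real" assume z: "norm z \<le> 1"
      show "blinfun_apply (blinfun_apply (t *\<^sub>R B) z) z + K * (\<Sum>x\<leftarrow>?ys. (blinfun_apply z x)\<^sup>2) \<le> t * r"
        using mult_left_mono[OF r(2)[rule_format, OF z], of t] t unfolding ys by (simp add: blinfun.scaleR_left algebra_simps)
    qed
    from p_le[OF this] have "p (t *\<^sub>R B) \<le> t * a" unfolding ys r(1) by (simp add: algebra_simps)
    also have "\<dots> \<le> t * (p B + e / t)" using a(2) t by simp
    also have "\<dots> = t * p B + e" using t by (simp add: field_simps)
    finally show "p (t *\<^sub>R B) \<le> t * p B + e" .
  qed
  have hom: "p (t *\<^sub>R B) = t * p B" if t: "t \<ge> 0" for t B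
  proof (cases "t = 0")
    case True then show ?thesis using p0 by simp
  next
    case False
    then have t': "t > 0" using t by simp
    have "p B \<le> (1/t) * p (t *\<^sub>R B)" using hom1[of "1/t" "t *\<^sub>R B"] t' by simp
    then have "t * p B \<le> p (t *\<^sub>R B)" using t' by (simp add: field_simps)
    then show ?thesis using hom1[OF t', of B] by simp
  qed
  obtain L where L: "linear L" "\<And>B. L B \<le> p B"
    using hahn_banach[of p "{0}" "\<lambda>_. 0", OF sub hom] p0 by (auto simp: linear_map_on_def)
  have L0: "L B \<le> 0" if "\<And>z. blinfun_apply (blinfun_apply B z) z = 0" for B
    using L(2)[of B] p_le[OF AI[of B "[]" 0]] that by simp
  define b where "b x y = L (tensor_form x y)" for x y
  have "linear (b x)" for x
  proof (rule linearI)
    fix y y' c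
    have "tensor_form x (y + y') = tensor_form x y + tensor_form x y'"
      "tensor_form x (c *\<^sub>R y) = c *\<^sub>R tensor_form x y"
      by (auto intro!: blinfun_eqI simp: blinfun.add_left blinfun.add_right blinfun.scaleR_left blinfun.scaleR_right algebra_simps)
    then show "b x (y + y') = b x y + b x y'" "b x (c *\<^sub>R y) = c *\<^sub>R b x y"
      using L(1) by (simp_all add: b_def linear_add linear_scale)
  qed
  moreover have "b x y = b y x" for x y
    using L0[of "tensor_form x y - tensor_form y x"] L0[of "tensor_form y x - tensor_form x y"] L(1)
    by (simp add: b_def linear_diff blinfun.diff_left)
  moreover have "b x x \<le> (norm x)\<^sup>2" for x
  proof -
    have "(norm x)\<^sup>2 - (\<Sum>x\<leftarrow>[]. (norm (x::'a))\<^sup>2) \<in> A (tensor_form x x)"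
    proof (rule AI)
      fix z :: "'a \<Rightarrow>\<^sub>L real" assume z: "norm z \<le> 1"
      have "\<bar>blinfun_apply z x\<bar> \<le> 1 * norm x"
        using order_trans[OF norm_blinfun[of z x] mult_right_mono[OF z norm_ge_zero]] by simp
      then have "\<bar>blinfun_apply z x\<bar>\<^sup>2 \<le> (norm x)\<^sup>2" by (intro power_mono) auto
      then show "blinfun_apply (blinfun_apply (tensor_form x x) z) z + K * (\<Sum>x\<leftarrow>[]. (blinfun_apply z x)\<^sup>2) \<le> (norm x)\<^sup>2"
        by (simp add: power2_eq_square)
    qed
    from p_le[OF this] show ?thesis using L(2)[of "tensor_form x x"] by (simp add: b_def)
  qed
  moreover have "(norm x)\<^sup>2 \<le> K * b x x" for x
  proof -
    have "0 - (\<Sum>x\<leftarrow>[x]. (norm x)\<^sup>2) \<in> A (- K *\<^sub>R tensor_form x x)"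
    proof (rule AI)
      show "blinfun_apply (blinfun_apply (- K *\<^sub>R tensor_form x x) z) z + K * (\<Sum>x\<leftarrow>[x]. (blinfun_apply z x)\<^sup>2) \<le> 0" for z
        by (simp only: blinfun.scaleR_left tensor_form_apply) (simp add: power2_eq_square)
    qed
    from p_le[OF this] have "L (- K *\<^sub>R tensor_form x x) \<le> - (norm x)\<^sup>2" 
      using L(2)[of "- K *\<^sub>R tensor_form x x"] unfolding list.map sum_list.Cons sum_list.Nil by linarith
    then show ?thesis using linear_scale[OF L(1), of "- K" "tensor_form x x"] unfolding b_def by simp
  qed
  ultimately show ?thesis by blast
qed

text \<open>Gram-Schmidt: finitely many vectors never span the space, so there is always a next one.\<close>
lemma exists_orthonormal:
  fixes b :: "'a::real_vector \<Rightarrow> 'a \<Rightarrow> real"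
  assumes lin: "\<And>x. linear (b x)" and sym: "\<And>x y. b x y = b y x"
    and pos: "\<And>x. x \<noteq> 0 \<Longrightarrow> b x x > 0"
    and inf: "infinite_dimensional (UNIV :: 'a set)"
  shows "\<exists>e :: nat \<Rightarrow> 'a. \<forall>i<n. \<forall>j<n. b (e i) (e j) = (if i = j then 1 else 0)"
proof (induction n)
  case 0
  then show ?case by simp
next
  case (Suc n)
  then obtain e where e: "\<And>i j. i < n \<Longrightarrow> j < n \<Longrightarrow> b (e i) (e j) = (if i = j then 1 else 0)" by blast
  obtain v where v: "v \<notin> span (e ` {..<n})"
    using inf unfolding infinite_dimensional_def by (metis UNIV_I finite_imageI finite_lessThan subsetI subset_UNIV)
  define u where "u = v - (\<Sum>i<n. b v (e i) *\<^sub>R e i)"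
  have "(\<Sum>i<n. b v (e i) *\<^sub>R e i) \<in> span (e ` {..<n})"
    by (intro span_sum span_scale span_base) auto
  then have "u \<noteq> 0" using v by (auto simp: u_def)
  then have uu: "b u u > 0" by (rule pos)
  have orth: "b (e j) u = 0" if j: "j < n" for j
  proof -
    have "b (e j) u = b (e j) v - (\<Sum>i<n. b v (e i) * b (e j) (e i))"
      using lin by (simp add: u_def linear_diff linear_sum linear_scale)
    also have "(\<Sum>i<n. b v (e i) * b (e j) (e i)) = (\<Sum>i<n. if i = j then b v (e j) else 0)"
      using e j by (intro sum.cong) auto
    also have "\<dots> = b (e j) v" using j sym by simp
    finally show ?thesis by simp
  qed
  define w where "w = (1 / sqrt (b u u)) *\<^sub>R u"
  have wr: "b x w = b x u / sqrt (b u u)" for x using lin by (simp add: w_def linear_scale)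
  have ww: "b w w = 1"
    using uu by (simp add: wr sym[of w u])
  have ew: "b (e j) w = 0" if "j < n" for j using orth[OF that] by (simp add: wr)
  show ?case
    by (rule exI[of _ "e(n := w)"]) (use e ww ew sym in \<open>auto simp: less_Suc_eq\<close>)
qed

text \<open>
  The assumption on families \<open>ys\<close> is applied to the rescaled vectors \<open>\<parallel>x\<parallel> x\<close>, and the weak
  \<open>\<ell>\<^sup>1\<close>-norm of these is estimated by the Cauchy-Schwarz inequality.
\<close>
lemma one_summing_imp_two_summing:
  fixes xs :: "'a::real_normed_vector list"
  assumes C: "C \<ge> 0" and one: "\<And>(ys :: 'a list) w. w \<ge> 0 \<Longrightarrow>
      (\<And>z :: 'a \<Rightarrow>\<^sub>L real. (\<Sum>x\<leftarrow>ys. \<bar>blinfun_apply z x\<bar>) \<le> w * norm z) \<Longrightarrow> (\<Sum>x\<leftarrow>ys. norm x) \<le> C * w"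
    and w: "w \<ge> 0" and weak: "\<And>z :: 'a \<Rightarrow>\<^sub>L real. (\<Sum>x\<leftarrow>xs. (blinfun_apply z x)\<^sup>2) \<le> w * (norm z)\<^sup>2"
  shows "(\<Sum>x\<leftarrow>xs. (norm x)\<^sup>2) \<le> C\<^sup>2 * w"
proof -
  define s where "s = (\<Sum>x\<leftarrow>xs. (norm x)\<^sup>2)"
  have s0: "s \<ge> 0" unfolding s_def by (intro sum_list_nonneg) auto
  have "(\<Sum>x\<leftarrow>map (\<lambda>x. norm x *\<^sub>R x) xs. norm x) \<le> C * (sqrt s * sqrt w)"
  proof (rule one)
    show "0 \<le> sqrt s * sqrt w" using s0 w by simp
    fix z :: "'a \<Rightarrow>\<^sub>L real"
    have "(\<Sum>x\<leftarrow>map (\<lambda>x. norm x *\<^sub>R x) xs. \<bar>blinfun_apply z x\<bar>)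
        = (\<Sum>i<length xs. \<bar>norm (xs ! i)\<bar> * \<bar>blinfun_apply z (xs ! i)\<bar>)"
      by (simp add: o_def blinfun.scaleR_right abs_mult sum_list_sum_nth atLeast0LessThan)
    also have "\<dots> \<le> L2_set (\<lambda>i. norm (xs ! i)) {..<length xs} * L2_set (\<lambda>i. blinfun_apply z (xs ! i)) {..<length xs}"
      by (rule L2_set_mult_ineq)
    also have "\<dots> = sqrt s * sqrt (\<Sum>x\<leftarrow>xs. (blinfun_apply z x)\<^sup>2)"
      by (simp add: L2_set_def s_def sum_list_sum_nth atLeast0LessThan)
    also have "\<dots> \<le> sqrt s * sqrt (w * (norm z)\<^sup>2)"
      using weak s0 by (intro mult_left_mono) auto
    also have "\<dots> = sqrt s * sqrt w * norm z" by (simp add: real_sqrt_mult)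
    finally show "(\<Sum>x\<leftarrow>map (\<lambda>x. norm x *\<^sub>R x) xs. \<bar>blinfun_apply z x\<bar>) \<le> sqrt s * sqrt w * norm z" .
  qed
  then have le: "s \<le> C * sqrt w * sqrt s"
    by (simp add: o_def s_def power2_eq_square mult_ac)
  show ?thesis
  proof (cases "s = 0")
    case True
    then show ?thesis using w by (simp add: s_def[symmetric])
  next
    case False
    have "sqrt s * sqrt s \<le> C * sqrt w * sqrt s" using le s0 by simp
    then have "sqrt s \<le> C * sqrt w" by (rule mult_right_le_imp_le) (use False s0 in simp)
    then have "(sqrt s)\<^sup>2 \<le> (C * sqrt w)\<^sup>2" using s0 by (intro power_mono) auto
    then show ?thesis using s0 w by (simp add: power_mult_distrib s_def[symmetric])
  qed
qed

text \<open>
  The orthonormal vectors \<open>e i\<close> come from an inner product \<open>b\<close> with \<open>\<parallel>x\<parallel>\<^sup>2 / C\<^sup>2 \<le> b x x \<le> \<parallel>x\<parallel>\<^sup>2\<close>.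
  Hence \<open>n \<le> \<Sum> \<parallel>e i\<parallel> \<le> C \<cdot> C \<surd>n\<close>, which is false once \<open>n > C\<^sup>4\<close>.
\<close>
theorem dvoretzky_rogers:
  assumes inf: "infinite_dimensional (UNIV :: 'a::real_normed_vector set)" and e: "\<epsilon> > 0"
  shows "\<exists>xs :: 'a list. (\<Sum>x\<leftarrow>xs. norm x) = 1 \<and>
    (\<forall>z :: 'a \<Rightarrow>\<^sub>L real. (\<Sum>x\<leftarrow>xs. \<bar>blinfun_apply z x\<bar>) \<le> \<epsilon> * norm z)"
proof (rule ccontr)
  assume neg: "\<not> ?thesis"
  define C where "C = 1 / \<epsilon>"
  have C: "C > 0" using e by (simp add: C_def)
  have one: "(\<Sum>x\<leftarrow>xs. norm x) \<le> C * w"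
    if w: "w \<ge> 0" and weak: "\<And>z :: 'a \<Rightarrow>\<^sub>L real. (\<Sum>x\<leftarrow>xs. \<bar>blinfun_apply z x\<bar>) \<le> w * norm z" for xs :: "'a list" and w
  proof (rule ccontr)
    define s where "s = (\<Sum>x\<leftarrow>xs. norm x)"
    assume "\<not> (\<Sum>x\<leftarrow>xs. norm x) \<le> C * w"
    then have sw: "w < \<epsilon> * s" using e by (simp add: s_def[symmetric] C_def field_simps)
    then have s: "s > 0" using w e by (metis le_less_trans zero_less_mult_pos)
    let ?ys = "map (\<lambda>x. (1/s) *\<^sub>R x) xs"
    have "(\<Sum>x\<leftarrow>?ys. norm x) = (\<Sum>x\<leftarrow>xs. (1/s) * norm x)"
      using s by (simp add: o_def)
    then have "(\<Sum>x\<leftarrow>?ys. norm x) = 1"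
      using s by (simp only: sum_list_const_mult s_def[symmetric]) simp
    moreover have "(\<Sum>x\<leftarrow>?ys. \<bar>blinfun_apply z x\<bar>) \<le> \<epsilon> * norm z" for z :: "'a \<Rightarrow>\<^sub>L real"
    proof -
      have "(\<Sum>x\<leftarrow>?ys. \<bar>blinfun_apply z x\<bar>) = (1/s) * (\<Sum>x\<leftarrow>xs. \<bar>blinfun_apply z x\<bar>)"
        using s by (simp add: o_def blinfun.scaleR_right abs_mult flip: sum_list_const_mult)
      also have "\<dots> \<le> (1/s) * (w * norm z)" using s weak by (intro mult_left_mono) auto
      also have "\<dots> \<le> (1/s) * (\<epsilon> * s * norm z)" using s sw by (intro mult_left_mono mult_right_mono) auto
      also have "\<dots> = \<epsilon> * norm z" using s by simp
      finally show ?thesis .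
    qed
    ultimately show False using neg by blast
  qed
  obtain b :: "'a \<Rightarrow> 'a \<Rightarrow> real" where lin: "\<And>x. linear (b x)" and sym: "\<And>x y. b x y = b y x"
    and up: "\<And>x. b x x \<le> (norm x)\<^sup>2" and lo: "\<And>x. (norm x)\<^sup>2 \<le> C\<^sup>2 * b x x"
    using pietsch_inner_product[of "C\<^sup>2", OF _ one_summing_imp_two_summing[OF less_imp_le[OF C] one]] C
    by fastforce
  have pos: "b x x > 0" if "x \<noteq> 0" for x
  proof -
    have "0 < C\<^sup>2 * b x x" using lo[of x] that by (smt (verit) zero_less_norm_iff zero_less_power)
    then show ?thesis using C by (simp add: zero_less_mult_iff)
  qed
  obtain n :: nat where n: "real n > C ^ 4" using reals_Archimedean2 by blast
  have n0: "n > 0" using n C by (smt (verit) of_nat_0 not_gr_zero zero_less_power)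
  obtain e where e: "\<And>i j. i < n \<Longrightarrow> j < n \<Longrightarrow> b (e i) (e j) = (if i = j then 1 else 0)"
    using exists_orthonormal[OF lin sym pos inf, of n] by blast
  have "real n = (\<Sum>i<n. 1)" by simp
  also have "\<dots> \<le> (\<Sum>i<n. norm (e i))"
  proof (rule sum_mono)
    fix i assume "i \<in> {..<n}"
    then have "1\<^sup>2 \<le> (norm (e i))\<^sup>2" using up[of "e i"] e[of i i] by simp
    then show "1 \<le> norm (e i)" by (rule power2_le_imp_le) simp
  qed
  also have "\<dots> = (\<Sum>x\<leftarrow>map e [0..<n]. norm x)"
    by (simp add: o_def interv_sum_list_conv_sum_set_nat atLeast0LessThan)
  also have "\<dots> \<le> C * (C * sqrt n)"
  proof (rule one)
    show "0 \<le> C * sqrt n" using C by simp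
    fix z :: "'a \<Rightarrow>\<^sub>L real"
    \<comment> \<open>With these signs, \<open>z v\<close> is the sum of the absolute values.\<close>
    define t where "t i = sgn (blinfun_apply z (e i))" for i
    define v where "v = (\<Sum>i<n. t i *\<^sub>R e i)"
    have "b v v = (\<Sum>i<n. t i * b v (e i))"
      using lin[of v] by (subst (2) v_def) (simp add: linear_sum linear_scale)
    also have "\<dots> = (\<Sum>i<n. t i * t i)"
    proof (rule sum.cong[OF refl])
      fix i assume i: "i \<in> {..<n}"
      have "b v (e i) = b (e i) v" by (rule sym)
      also have "\<dots> = (\<Sum>j<n. t j * b (e i) (e j))"
        using lin[of "e i"] by (simp add: v_def linear_sum linear_scale)
      also have "\<dots> = (\<Sum>j<n. if j = i then t i else 0)"
        using e i by (intro sum.cong) auto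
      finally show "t i * b v (e i) = t i * t i" using i by simp
    qed
    also have "\<dots> \<le> (\<Sum>i<n. 1)" by (intro sum_mono) (auto simp: t_def sgn_if)
    finally have bv: "b v v \<le> n" by simp
    have "(norm v)\<^sup>2 \<le> C\<^sup>2 * n" by (rule order_trans[OF lo mult_left_mono[OF bv]]) simp
    also have "\<dots> = (C * sqrt n)\<^sup>2" by (simp add: power_mult_distrib)
    finally have nv: "norm v \<le> C * sqrt n" by (rule power2_le_imp_le) (use C in simp)
    have "(\<Sum>x\<leftarrow>map e [0..<n]. \<bar>blinfun_apply z x\<bar>) = (\<Sum>i<n. t i * blinfun_apply z (e i))"
      by (simp add: o_def interv_sum_list_conv_sum_set_nat atLeast0LessThan t_def abs_sgn mult.commute[of "sgn _"])
    also have "\<dots> = blinfun_apply z v" by (simp add: v_def blinfun.sum_right blinfun.scaleR_right)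
    also have "\<dots> \<le> norm z * norm v" using norm_blinfun[of z v] by simp
    also have "\<dots> \<le> norm z * (C * sqrt n)" using nv by (intro mult_left_mono) auto
    finally show "(\<Sum>x\<leftarrow>map e [0..<n]. \<bar>blinfun_apply z x\<bar>) \<le> C * sqrt n * norm z" by (simp add: mult.commute)
  qed
  finally have "sqrt n * sqrt n \<le> C\<^sup>2 * sqrt n" by (simp add: power2_eq_square mult.assoc)
  then have "sqrt n \<le> C\<^sup>2" by (rule mult_right_le_imp_le) (use n0 in simp)
  then have "(sqrt n)\<^sup>2 \<le> (C\<^sup>2)\<^sup>2" by (intro power_mono) auto
  then show False using n by (simp flip: power_mult)
qed

section \<open>Compactness in the space of bounded sequences and for adjoint functionals\<close>

lemma apply_Bcontfun_nat:
  fixes f :: "nat \<Rightarrow> real"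
  assumes "\<And>t. \<bar>f t\<bar> \<le> M"
  shows "apply_bcontfun (Bcontfun f) = f"
  using assms by (intro Bcontfun_inverse bcontfun_normI) auto

lemma norm_Bcontfun_nat_le:
  fixes f :: "nat \<Rightarrow> real"
  assumes "\<And>t. \<bar>f t\<bar> \<le> M"
  shows "norm (Bcontfun f) \<le> M"
  using assms by (intro norm_bound) (simp add: apply_Bcontfun_nat[OF assms])

text \<open>
  By Tychonoff's theorem the box is compact for coordinatewise convergence. On it this topology
  agrees with that of the supremum norm, because beyond finitely many coordinates all its elements
  are uniformly small.
\<close>
lemma compact_null_box:
  fixes c :: "nat \<Rightarrow> real"
  assumes c: "c \<longlonglongrightarrow> 0"
  shows "compact {s :: nat \<Rightarrow>\<^sub>C real. \<forall>t. \<bar>apply_bcontfun s t\<bar> \<le> c t}"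
proof -
  define B where "B = (PiE UNIV (\<lambda>t. {- c t..c t}) :: (nat \<Rightarrow> real) set)"
  have B: "r \<in> B \<longleftrightarrow> (\<forall>t. \<bar>r t\<bar> \<le> c t)" for r
    unfolding B_def PiE_iff by (auto simp: abs_le_iff)
      (metis minus_le_iff)+
  obtain M where M: "\<And>t. \<bar>c t\<bar> \<le> M"
    using convergent_imp_Bseq[OF convergentI[OF c]] unfolding Bseq_def by auto
  have app: "apply_bcontfun (Bcontfun r) = r" if "r \<in> B" for r
    using that B M by (intro apply_Bcontfun_nat[of _ M]) (metis abs_ge_self order_trans)
  have "compactin (product_topology (\<lambda>_. euclidean) UNIV) B"
    unfolding B_def by (simp add: compactin_PiE)
  then have cB: "compact B"
    unfolding euclidean_product_topology by simp
  have "continuous_on B Bcontfun"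
    unfolding continuous_on_def
  proof (intro ballI tendstoI)
    fix r and \<epsilon> :: real assume r: "r \<in> B" and e: "\<epsilon> > 0"
    obtain m where m: "\<And>t. t \<ge> m \<Longrightarrow> c t < \<epsilon> / 4"
      using order_tendstoD(2)[OF c, of "\<epsilon>/4"] e unfolding eventually_sequentially by auto
    have "\<forall>\<^sub>F s in at r within B. \<bar>s t - r t\<bar> < \<epsilon> / 2" for t
    proof -
      have "continuous_on B (\<lambda>s :: nat \<Rightarrow> real. s t)" 
        by (rule continuous_on_subset[OF continuous_on_product_coordinates subset_UNIV])
      then have "((\<lambda>s. s t) \<longlongrightarrow> r t) (at r within B)" using r unfolding continuous_on_def by blast
      from tendstoD[OF this, of "\<epsilon>/2"] e show ?thesis by (simp add: dist_real_def)
    qed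
    then have "\<forall>\<^sub>F s in at r within B. \<forall>t\<in>{..<m}. \<bar>s t - r t\<bar> < \<epsilon> / 2"
      by (intro eventually_ball_finite) auto
    moreover have "\<forall>\<^sub>F s in at r within B. s \<in> B"
      by (simp add: eventually_at_filter)
    ultimately show "\<forall>\<^sub>F s in at r within B. dist (Bcontfun s) (Bcontfun r) < \<epsilon>"
    proof eventually_elim
      case (elim s)
      have "dist (Bcontfun s) (Bcontfun r) \<le> \<epsilon> / 2"
      proof (rule dist_bound)
        fix t
        show "dist (apply_bcontfun (Bcontfun s) t) (apply_bcontfun (Bcontfun r) t) \<le> \<epsilon> / 2"
        proof (cases "t < m")
          case True
          then show ?thesis using elim r by (auto simp: app dist_real_def intro: less_imp_le)
        next
          case False
          then have "\<bar>s t\<bar> \<le> \<epsilon>/4" "\<bar>r t\<bar> \<le> \<epsilon>/4"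
            using m[of t] elim(2) r unfolding B by (meson le_less_trans less_imp_le not_less)+
          then have "\<bar>s t - r t\<bar> \<le> \<epsilon> / 2" by linarith
          then show ?thesis using elim(2) r by (simp add: app dist_real_def)
        qed
      qed
      then show ?case using e by simp
    qed
  qed
  then have "compact (Bcontfun ` B)" using cB by (rule compact_continuous_image)
  moreover have "Bcontfun ` B = {s. \<forall>t. \<bar>apply_bcontfun s t\<bar> \<le> c t}"
  proof (intro equalityI subsetI)
    fix s assume "s \<in> {s. \<forall>t. \<bar>apply_bcontfun s t\<bar> \<le> c t}"
    then have "apply_bcontfun s \<in> B" by (simp add: B)
    moreover have "s = Bcontfun (apply_bcontfun s)" by (simp add: apply_bcontfun_inverse)
    ultimately show "s \<in> Bcontfun ` B" by blast
  qed (auto simp: app B)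
  ultimately show ?thesis by simp
qed

text \<open>
  This is the part of Schauder's theorem on adjoints that matters here. Up to a small error, a
  functional composed with \<open>T\<close> is determined by its values on a finite net \<open>Y\<close> of the image of the
  unit ball; rounding these values to multiples of \<open>d\<close> leaves only finitely many patterns \<open>h t\<close>, and
  one representative of each pattern suffices.
\<close>
lemma compact_adjoint_net:
  fixes T :: "'a::real_normed_vector \<Rightarrow>\<^sub>L 'b::real_normed_vector" and \<psi> :: "nat \<Rightarrow> 'b \<Rightarrow>\<^sub>L real"
  assumes T: "T \<in> compact_operators" and \<psi>: "\<And>t. norm (\<psi> t) \<le> M" and e: "e > 0"
  shows "\<exists>Z. finite Z \<and> (\<forall>t. \<exists>z\<in>Z. norm ((\<psi> t o\<^sub>L T) - z) \<le> e)"
proof -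
  have M: "M \<ge> 0" using \<psi>[of 0] norm_ge_zero order_trans by blast
  \<comment> \<open>One \<open>d\<close> is lost by rounding and \<open>M * d\<close> twice by passing to the net.\<close>
  define d where "d = e / (1 + 2 * M)"
  have d: "d > 0" using e M by (simp add: d_def)
  have de: "d * (1 + 2 * M) = e" using M by (simp add: d_def)
  let ?K = "closure (blinfun_apply T ` cball 0 1)"
  obtain Y where Y: "finite Y" "?K \<subseteq> (\<Union>y\<in>Y. ball y d)"
    using seq_compact_imp_totally_bounded[of ?K] T d unfolding compact_operators_def
    by (auto simp: compact_eq_seq_compact_metric)
  define h where "h t = restrict (\<lambda>y. \<lfloor>blinfun_apply (\<psi> t) y / d\<rfloor>) Y" for t
  have "range h \<subseteq> PiE Y (\<lambda>y. {\<lfloor>- (M * norm y) / d\<rfloor>..\<lfloor>M * norm y / d\<rfloor>})"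
  proof (clarsimp simp: h_def PiE_iff)
    fix t y
    have "\<bar>blinfun_apply (\<psi> t) y\<bar> \<le> M * norm y"
      using order_trans[OF norm_blinfun[of "\<psi> t" y] mult_right_mono[OF \<psi> norm_ge_zero]] by simp
    then have "- (M * norm y) / d \<le> blinfun_apply (\<psi> t) y / d" "blinfun_apply (\<psi> t) y / d \<le> M * norm y / d"
      using d by (auto simp: divide_le_cancel abs_le_iff minus_divide_left simp del: minus_divide_left[symmetric])
    then show "\<lfloor>- (M * norm y / d)\<rfloor> \<le> \<lfloor>blinfun_apply (\<psi> t) y / d\<rfloor> \<and> \<lfloor>blinfun_apply (\<psi> t) y / d\<rfloor> \<le> \<lfloor>M * norm y / d\<rfloor>"
      by (auto intro!: floor_mono)
  qed
  then have fin: "finite (range h)"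
    by (rule finite_subset) (intro finite_PiE Y(1) finite_atLeastAtMost_int)
  define rep where "rep v = (SOME t. h t = v)" for v
  have rep: "h (rep (h t)) = h t" for t unfolding rep_def by (rule someI) simp
  have "norm ((\<psi> t o\<^sub>L T) - (\<psi> (rep (h t)) o\<^sub>L T)) \<le> e" for t
  proof (rule norm_blinfun_bound)
    define s where "s = rep (h t)"
    have close: "\<bar>blinfun_apply (\<psi> t) y - blinfun_apply (\<psi> s) y\<bar> \<le> d" if y: "y \<in> Y" for y
    proof -
      have "\<lfloor>blinfun_apply (\<psi> t) y / d\<rfloor> = \<lfloor>blinfun_apply (\<psi> s) y / d\<rfloor>"
        using fun_cong[OF rep[of t], of y] y by (simp add: h_def s_def)
      then have "\<bar>blinfun_apply (\<psi> t) y / d - blinfun_apply (\<psi> s) y / d\<bar> \<le> 1" by linarith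
      then show ?thesis using d by (simp add: field_simps abs_le_iff)
    qed
    have unit: "\<bar>blinfun_apply (\<psi> t) (blinfun_apply T u) - blinfun_apply (\<psi> s) (blinfun_apply T u)\<bar> \<le> e"
      if "norm u \<le> 1" for u
    proof -
      have "blinfun_apply T u \<in> ?K" using that by (intro closure_subset[THEN subsetD]) auto
      then obtain y where y: "y \<in> Y" "dist y (blinfun_apply T u) < d" using Y(2) by auto
      have n: "\<bar>blinfun_apply (\<psi> r) (blinfun_apply T u) - blinfun_apply (\<psi> r) y\<bar> \<le> M * d" for r
      proof -
        have "\<bar>blinfun_apply (\<psi> r) (blinfun_apply T u - y)\<bar> \<le> norm (\<psi> r) * norm (blinfun_apply T u - y)"
          using norm_blinfun[of "\<psi> r" "blinfun_apply T u - y"] by simp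
        also have "\<dots> \<le> M * d" using \<psi> M y(2) by (intro mult_mono) (auto simp: dist_norm norm_minus_commute)
        finally show ?thesis by (simp add: blinfun.diff_right)
      qed
      have "d + 2 * (M * d) = e" using de by (simp add: algebra_simps)
      then show ?thesis using n[of t] n[of s] close[OF y(1)] by linarith
    qed
    show "norm (blinfun_apply ((\<psi> t o\<^sub>L T) - (\<psi> (rep (h t)) o\<^sub>L T)) x) \<le> e * norm x" for x
    proof (cases "x = 0")
      case False
      have "norm ((1 / norm x) *\<^sub>R x) \<le> 1" using False by simp
      from unit[OF this] False show ?thesis
        by (simp add: blinfun.diff_left blinfun.scaleR_right s_def[symmetric] divide_le_eq abs_mult
            flip: diff_divide_distrib)
    qed (simp add: blinfun.zero_right)
  qed (use e in simp)
  then show ?thesis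
    using fin by (intro exI[of _ "(\<lambda>v. \<psi> (rep v) o\<^sub>L T) ` range h"]) blast
qed

section \<open>Copies of the sequence spaces\<close>

lemma linear_map_on_bounded:
  fixes f :: "'a::real_normed_vector \<Rightarrow> 'b::real_normed_vector"
  assumes V: "subspace V" and lin: "linear_map_on V f" and cont: "continuous_on V f"
  shows "\<exists>K\<ge>0. \<forall>x\<in>V. norm (f x) \<le> K * norm x"
proof -
  have 0: "0 \<in> V" using V by (rule subspace_0)
  then have f0: "f 0 = 0" using lin unfolding linear_map_on_def by (metis scaleR_zero_left)
  obtain d where d: "d > 0" "\<And>x. x \<in> V \<Longrightarrow> norm x < d \<Longrightarrow> norm (f x) < 1"
    using cont 0 f0 unfolding continuous_on_iff by (metis dist_0_norm dist_commute zero_less_one)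
  have "norm (f x) \<le> 2 / d * norm x" if x: "x \<in> V" for x
  proof (cases "x = 0")
    case False
    define c where "c = d / (2 * norm x)"
    have c: "c > 0" using d(1) False by (simp add: c_def)
    have "norm (c *\<^sub>R x) = d / 2" using d(1) False by (simp add: c_def)
    then have "norm (f (c *\<^sub>R x)) < 1" using d subspace_scale[OF V x, of c] by simp
    moreover have "f (c *\<^sub>R x) = c *\<^sub>R f x" using lin x unfolding linear_map_on_def by blast
    ultimately have "c * norm (f x) < 1" using c by simp
    then show ?thesis using d(1) False by (simp add: c_def field_simps)
  qed (simp add: f0)
  then show ?thesis using d(1) by (intro exI[of _ "2/d"]) auto
qed

text \<open>
  The coordinates of the homeomorphism onto \<open>\<ell>\<^sup>\<infinity>\<close> are uniformly bounded functionals on the copy, and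
  each of them is extended separately to the whole space with the same bound.
\<close>
lemma l_infinity_copy_coordinates:
  assumes "contains_copy (UNIV :: 'b::real_normed_vector set) l_infinity"
  shows "\<exists>(J :: (nat \<Rightarrow>\<^sub>C real) \<Rightarrow> 'b) (\<psi> :: nat \<Rightarrow> 'b \<Rightarrow>\<^sub>L real) M. bounded_linear J \<and>
    (\<forall>t. norm (\<psi> t) \<le> M) \<and> (\<forall>t s. blinfun_apply (\<psi> t) (J s) = apply_bcontfun s t)"
proof -
  obtain G :: "'b set" and f and g :: "(nat \<Rightarrow>\<^sub>C real) \<Rightarrow> 'b" where G: "subspace G" and
    lin: "linear_map_on G f" and hom: "homeomorphism G UNIV f g"
    using assms unfolding contains_copy_def isomorphic_copy_in_def linearly_homeomorphic_def l_infinity_def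
    by blast
  have gG: "g s \<in> G" and fg: "f (g s) = s" for s
    using hom unfolding homeomorphism_def by auto
  have gf: "g (f y) = y" if "y \<in> G" for y
    using hom that unfolding homeomorphism_def by auto
  have cf: "continuous_on G f" and cg: "continuous_on UNIV g"
    using hom unfolding homeomorphism_def by auto
  obtain K where K: "K \<ge> 0" "\<And>y. y \<in> G \<Longrightarrow> norm (f y) \<le> K * norm y"
    using linear_map_on_bounded[OF G lin cf] by blast
  have glin: "g (s + s') = g s + g s'" "g (c *\<^sub>R s) = c *\<^sub>R g s" for s s' c
  proof -
    have "f (g s + g s') = s + s'" "f (c *\<^sub>R g s) = c *\<^sub>R s"
      using lin gG fg unfolding linear_map_on_def by simp_all
    then show "g (s + s') = g s + g s'" "g (c *\<^sub>R s) = c *\<^sub>R g s"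
      using gf[of "g s + g s'"] gf[of "c *\<^sub>R g s"] subspace_add[OF G gG gG] subspace_scale[OF G gG]
      by simp_all
  qed
  obtain N where N: "N \<ge> 0" "\<And>s. norm (g s) \<le> N * norm s"
    using linear_map_on_bounded[of UNIV g] cg glin by (auto simp: linear_map_on_def)
  have "bounded_linear g"
    using glin N by (intro bounded_linear_intro[where K=N]) (auto simp: mult.commute)
  moreover have "\<exists>z :: 'b \<Rightarrow>\<^sub>L real. (\<forall>y\<in>G. blinfun_apply z y = apply_bcontfun (f y) t) \<and> norm z \<le> K" for t
  proof (rule bounded_functional_extension[OF G])
    show "linear_map_on G (\<lambda>y. apply_bcontfun (f y) t)"
      using lin unfolding linear_map_on_def by simp
    show "\<bar>apply_bcontfun (f y) t\<bar> \<le> K * norm y" if "y \<in> G" for y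
      using order_trans[OF norm_bounded K(2)[OF that]] by simp
  qed (fact K(1))
  then obtain \<psi> :: "nat \<Rightarrow> 'b \<Rightarrow>\<^sub>L real" where
    "\<And>t y. y \<in> G \<Longrightarrow> blinfun_apply (\<psi> t) y = apply_bcontfun (f y) t" "\<And>t. norm (\<psi> t) \<le> K"
    by metis
  ultimately show ?thesis using gG fg by (intro exI[of _ g] exI[of _ \<psi>] exI[of _ K]) simp
qed

text \<open>
  The copy is \<open>S ` c_zero\<close>. It is closed in \<open>E\<close> because it is the fixed point set there of the
  continuous map \<open>S \<circ> \<Phi>\<close>, which is also the projection.
\<close>
lemma contains_complemented_c_zeroI:
  fixes S :: "(nat \<Rightarrow>\<^sub>C real) \<Rightarrow> 'e::real_normed_vector" and \<Phi> :: "'e \<Rightarrow> nat \<Rightarrow>\<^sub>C real"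
  assumes S: "bounded_linear S" and \<Phi>: "bounded_linear \<Phi>" and inv: "\<And>a. \<Phi> (S a) = a"
    and SE: "S ` c_zero \<subseteq> E" and \<Phi>E: "\<Phi> ` E \<subseteq> c_zero"
  shows "contains_complemented_copy E (c_zero :: (nat \<Rightarrow>\<^sub>C real) set)"
proof -
  define G where "G = S ` c_zero"
  have GE: "G \<subseteq> E" using SE by (simp add: G_def)
  have \<Phi>G: "\<Phi> ` G = c_zero" by (force simp: G_def inv)
  have lin: "linear_map_on V f" if "bounded_linear f" for V and f :: "'x::real_normed_vector \<Rightarrow> 'y::real_normed_vector"
    using that by (simp add: linear_map_on_def bounded_linear_def linear_add linear_scale)
  have cont: "continuous_on V f" if "bounded_linear f" for V and f :: "'x::real_normed_vector \<Rightarrow> 'y::real_normed_vector"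
    by (rule linear_continuous_on[OF that])
  have P: "bounded_linear (\<lambda>x. S (\<Phi> x))" by (rule bounded_linear_compose[OF S \<Phi>])
  have "subspace (c_zero :: (nat \<Rightarrow>\<^sub>C real) set)"
    unfolding subspace_def c_zero_def by (auto intro: tendsto_eq_intros simp: fun_eq_iff)
  then have "subspace G"
    unfolding G_def using S by (intro linear_subspace_image bounded_linear.linear)
  moreover have "closedin (top_of_set E) G"
  proof -
    have "G = E \<inter> {x. S (\<Phi> x) = x}"
      using \<Phi>E GE by (auto simp: G_def inv) (metis image_eqI image_subset_iff)
    moreover have "closed {x. S (\<Phi> x) = x}"
      using cont[OF P] by (intro closed_Collect_eq) auto
    ultimately show ?thesis by (metis closedin_closed_Int)
  qed
  moreover have "homeomorphism G c_zero \<Phi> S"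
    unfolding homeomorphism_def using \<Phi>G cont[OF S] cont[OF \<Phi>] by (auto simp: G_def inv)
  moreover have "continuous_projection_onto E G (\<lambda>x. S (\<Phi> x))"
  proof -
    have "(\<lambda>x. S (\<Phi> x)) ` E = G"
    proof
      show "(\<lambda>x. S (\<Phi> x)) ` E \<subseteq> G" using \<Phi>E by (auto simp: G_def)
      show "G \<subseteq> (\<lambda>x. S (\<Phi> x)) ` E"
        using GE by (auto simp: G_def) (metis image_eqI image_subset_iff inv)
    qed
    then show ?thesis using lin[OF P] cont[OF P] by (simp add: continuous_projection_onto_def inv)
  qed
  ultimately show ?thesis
    using GE lin[OF \<Phi>] unfolding contains_complemented_copy_def isomorphic_copy_in_def linearly_homeomorphic_def
    by blast
qed

section \<open>Block diagonal operators\<close>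

text \<open>Each value \<open>\<bar>a k\<bar>\<close> is repeated only \<open>n k\<close> times.\<close>
lemma block_sequence_tendsto_zero:
  fixes a :: "nat \<Rightarrow> real"
  assumes a: "a \<longlonglongrightarrow> 0"
  shows "(\<lambda>t. let (k, i) = prod_decode t in if i < n k then \<bar>a k\<bar> else 0) \<longlonglongrightarrow> 0" (is "?c \<longlonglongrightarrow> 0")
proof (rule tendstoI)
  fix \<epsilon> :: real assume e: "\<epsilon> > 0"
  obtain m where m: "\<And>k. k \<ge> m \<Longrightarrow> \<bar>a k\<bar> < \<epsilon>"
    using a e unfolding LIMSEQ_iff by auto
  have "{t. \<not> dist (?c t) 0 < \<epsilon>} \<subseteq> prod_encode ` (SIGMA k:{..<m}. {..<n k})"
  proof
    fix t assume t: "t \<in> {t. \<not> dist (?c t) 0 < \<epsilon>}"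
    obtain k i where ki: "prod_decode t = (k, i)" by fastforce
    have "i < n k" "k < m"
      using t e m[of k] ki by (auto simp: not_le[symmetric] split: if_splits)
    moreover have "t = prod_encode (k, i)" using ki by (metis prod_decode_inverse)
    ultimately show "t \<in> prod_encode ` (SIGMA k:{..<m}. {..<n k})" by blast
  qed
  then have "finite {t. \<not> dist (?c t) 0 < \<epsilon>}" by (rule finite_subset) auto
  then show "\<forall>\<^sub>F t in sequentially. dist (?c t) 0 < \<epsilon>"
    by (simp flip: cofinite_eq_sequentially add: eventually_cofinite)
qed

text \<open>
  Replacing every \<open>\<psi>\<^sub>t \<circ> T\<close> by a member of a finite \<open>\<epsilon>/2\<close>-net \<open>Z\<close> costs at most \<open>\<epsilon>/2\<close>, since the norms
  in a block add up to one. The member chosen may vary with \<open>i\<close>, so the sum over all of \<open>Z\<close> is used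
  as a bound.
\<close>
lemma compact_operator_pairing_tendsto_zero:
  fixes T :: "'a::real_normed_vector \<Rightarrow>\<^sub>L 'b::real_normed_vector" and \<psi> :: "nat \<Rightarrow> 'b \<Rightarrow>\<^sub>L real"
    and x :: "nat \<Rightarrow> nat \<Rightarrow> 'a"
  assumes T: "T \<in> compact_operators" and \<psi>: "\<And>t. norm (\<psi> t) \<le> M"
    and x1: "\<And>k. (\<Sum>i<n k. norm (x k i)) = 1"
    and x2: "\<And>k (z :: 'a \<Rightarrow>\<^sub>L real). (\<Sum>i<n k. \<bar>blinfun_apply z (x k i)\<bar>) \<le> (1 / real (Suc k)) * norm z"
  shows "(\<lambda>k. \<Sum>i<n k. blinfun_apply (\<psi> (prod_encode (k, i))) (blinfun_apply T (x k i))) \<longlonglongrightarrow> 0"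
    (is "?\<phi> \<longlonglongrightarrow> 0")
proof (rule tendstoI)
  fix \<epsilon> :: real assume e: "\<epsilon> > 0"
  have e2: "\<epsilon> / 2 > 0" using e by simp
  obtain Z where Z: "finite Z" "\<And>t. \<exists>w\<in>Z. norm ((\<psi> t o\<^sub>L T) - w) \<le> \<epsilon> / 2"
    using compact_adjoint_net[OF T, where \<psi> = \<psi> and e = "\<epsilon> / 2", OF \<psi> e2] by blast
  define R where "R = (\<Sum>w\<in>Z. norm w)"
  have bound: "\<bar>?\<phi> k\<bar> \<le> R / real (Suc k) + \<epsilon> / 2" for k
  proof -
    have "\<bar>?\<phi> k\<bar> \<le> (\<Sum>i<n k. (\<Sum>w\<in>Z. \<bar>blinfun_apply w (x k i)\<bar>) + \<epsilon> / 2 * norm (x k i))"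
    proof (rule order_trans[OF sum_abs sum_mono])
      fix i
      let ?t = "prod_encode (k, i)"
      obtain w where w: "w \<in> Z" "norm ((\<psi> ?t o\<^sub>L T) - w) \<le> \<epsilon> / 2" using Z(2) by blast
      have "\<bar>blinfun_apply ((\<psi> ?t o\<^sub>L T) - w) (x k i)\<bar> \<le> \<epsilon> / 2 * norm (x k i)"
        using order_trans[OF norm_blinfun mult_right_mono[OF w(2) norm_ge_zero]] by simp
      moreover have "\<bar>blinfun_apply w (x k i)\<bar> \<le> (\<Sum>w\<in>Z. \<bar>blinfun_apply w (x k i)\<bar>)"
        using w(1) Z(1) by (intro member_le_sum) auto
      ultimately show "\<bar>blinfun_apply (\<psi> ?t) (blinfun_apply T (x k i))\<bar>
          \<le> (\<Sum>w\<in>Z. \<bar>blinfun_apply w (x k i)\<bar>) + \<epsilon> / 2 * norm (x k i)"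
        unfolding blinfun.diff_left blinfun_apply_blinfun_compose by linarith
    qed
    also have "\<dots> = (\<Sum>w\<in>Z. \<Sum>i<n k. \<bar>blinfun_apply w (x k i)\<bar>) + \<epsilon> / 2"
      by (subst sum.swap) (simp only: sum.distrib x1 mult_1_right flip: sum_distrib_left)
    also have "(\<Sum>w\<in>Z. \<Sum>i<n k. \<bar>blinfun_apply w (x k i)\<bar>) \<le> (\<Sum>w\<in>Z. (1 / real (Suc k)) * norm w)"
      by (intro sum_mono x2)
    also have "\<dots> = R / real (Suc k)" by (simp only: R_def flip: sum_distrib_left) simp
    finally show ?thesis by simp
  qed
  have "(\<lambda>k. R / real (Suc k)) \<longlonglongrightarrow> 0"
    by (rule real_tendsto_divide_at_top[OF tendsto_const]) (rule filterlim_compose[OF filterlim_real_sequentially filterlim_Suc])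
  then have "\<forall>\<^sub>F k in sequentially. R / real (Suc k) < \<epsilon> / 2"
    by (rule order_tendstoD(2)) (use e in simp)
  then show "\<forall>\<^sub>F k in sequentially. dist (?\<phi> k) 0 < \<epsilon>"
  proof eventually_elim
    case (elim k)
    then show ?case using bound[of k] unfolding dist_real_def diff_0_right by linarith
  qed
qed

theorem mainTheorem1:
  assumes "infinite_dimensional (UNIV :: 'a::banach set)"
    and "infinite_dimensional (UNIV :: 'b::banach set)"
    and "contains_copy (UNIV :: 'b set) l_infinity"
  shows "contains_complemented_copy (compact_operators :: ('a \<Rightarrow>\<^sub>L 'b) set) c_zero"
proof -
  obtain J :: "(nat \<Rightarrow>\<^sub>C real) \<Rightarrow> 'b" and \<psi> :: "nat \<Rightarrow> 'b \<Rightarrow>\<^sub>L real" and M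
    where J: "bounded_linear J" and \<psi>: "\<And>t. norm (\<psi> t) \<le> M"
      and \<psi>J: "\<And>t s. blinfun_apply (\<psi> t) (J s) = apply_bcontfun s t"
    using l_infinity_copy_coordinates[OF assms(3)] by blast
  have M: "M \<ge> 0" using \<psi>[of 0] norm_ge_zero order_trans by blast
  have "\<exists>xs :: 'a list. (\<Sum>x\<leftarrow>xs. norm x) = 1 \<and>
    (\<forall>z :: 'a \<Rightarrow>\<^sub>L real. (\<Sum>x\<leftarrow>xs. \<bar>blinfun_apply z x\<bar>) \<le> (1 / real (Suc k)) * norm z)" for k
    by (rule dvoretzky_rogers[OF assms(1)]) simp
  then obtain xs :: "nat \<Rightarrow> 'a list" where xs: "\<And>k. (\<Sum>x\<leftarrow>xs k. norm x) = 1"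
    "\<And>k (z :: 'a \<Rightarrow>\<^sub>L real). (\<Sum>x\<leftarrow>xs k. \<bar>blinfun_apply z x\<bar>) \<le> (1 / real (Suc k)) * norm z"
    by metis
  define n where "n k = length (xs k)" for k
  define x where "x k i = xs k ! i" for k i
  have x1: "(\<Sum>i<n k. norm (x k i)) = 1" for k
    using xs(1)[of k] by (simp add: sum_list_sum_nth atLeast0LessThan n_def x_def)
  have x2: "(\<Sum>i<n k. \<bar>blinfun_apply z (x k i)\<bar>) \<le> (1 / real (Suc k)) * norm z" for k and z :: "'a \<Rightarrow>\<^sub>L real"
    using xs(2)[where k=k and z=z] by (simp add: sum_list_sum_nth atLeast0LessThan n_def x_def)
  obtain z :: "nat \<Rightarrow> nat \<Rightarrow> 'a \<Rightarrow>\<^sub>L real" where z: "\<And>k i. norm (z k i) \<le> 1"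
    "\<And>k i. blinfun_apply (z k i) (x k i) = norm (x k i)"
    using norming_functional[of "x _ _"] by metis
  \<comment> \<open>The coordinate with code \<open>(k, i)\<close> belongs to block \<open>k\<close>; codes with \<open>i \<ge> n k\<close> stay empty.\<close>
  define q where "q a v t = (let (k, i) = prod_decode t in
      if i < n k then apply_bcontfun a k * blinfun_apply (z k i) v else 0)"
    for a :: "nat \<Rightarrow>\<^sub>C real" and v t
  define D where "D a v = Bcontfun (q a v)" for a v
  have zv: "\<bar>blinfun_apply (z k i) v\<bar> \<le> norm v" for k i v
    using order_trans[OF norm_blinfun[of "z k i" v] mult_right_mono[OF z(1) norm_ge_zero]] by simp
  have qb: "\<bar>q a v t\<bar> \<le> norm a * norm v" for a v t
    using mult_mono[OF norm_bounded[of a] zv[of _ _ v]]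
    by (auto simp: q_def abs_mult split: prod.split)
  have Dq: "apply_bcontfun (D a v) = q a v" for a v
    unfolding D_def by (rule apply_Bcontfun_nat[OF qb])
  have Dn: "norm (D a v) \<le> norm a * norm v * 1" for a v
    unfolding D_def using norm_Bcontfun_nat_le[OF qb] by simp
  interpret D: bounded_bilinear D
  proof
    show "\<exists>K. \<forall>a v. norm (D a v) \<le> norm a * norm v * K" using Dn by blast
  qed (auto intro!: bcontfun_eqI simp: Dq q_def algebra_simps blinfun.add_right blinfun.scaleR_right split: prod.split)
  define S where "S a = Blinfun J o\<^sub>L D.prod_right a" for a
  have Sv: "blinfun_apply (S a) v = J (D a v)" for a v
    by (simp add: S_def bounded_linear_Blinfun_apply[OF J])
  have S: "bounded_linear S"
    unfolding S_def
    by (intro bounded_linear_compose[OF bounded_bilinear.bounded_linear_right[OF bounded_bilinear_blinfun_compose] D.bounded_linear_prod_right])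
  define \<phi> where "\<phi> T k = (\<Sum>i<n k. blinfun_apply (\<psi> (prod_encode (k, i))) (blinfun_apply T (x k i)))"
    for T :: "'a \<Rightarrow>\<^sub>L 'b" and k
  define \<Phi> where "\<Phi> T = Bcontfun (\<phi> T)" for T
  have \<phi>b: "\<bar>\<phi> T k\<bar> \<le> M * norm T" for T k
  proof -
    have "\<bar>\<phi> T k\<bar> \<le> (\<Sum>i<n k. M * norm T * norm (x k i))"
      unfolding \<phi>_def
    proof (rule order_trans[OF sum_abs sum_mono])
      fix i
      have "\<bar>blinfun_apply (\<psi> (prod_encode (k, i))) (blinfun_apply T (x k i))\<bar>
          \<le> norm (\<psi> (prod_encode (k, i))) * norm (blinfun_apply T (x k i))"
        using norm_blinfun[of "\<psi> (prod_encode (k, i))" "blinfun_apply T (x k i)"] by simp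
      also have "\<dots> \<le> M * (norm T * norm (x k i))"
        using \<psi> M by (intro mult_mono norm_blinfun) auto
      finally show "\<bar>blinfun_apply (\<psi> (prod_encode (k, i))) (blinfun_apply T (x k i))\<bar> \<le> M * norm T * norm (x k i)"
        by (simp add: mult.assoc)
    qed
    also have "\<dots> = M * norm T" by (simp add: x1 flip: sum_distrib_left)
    finally show ?thesis .
  qed
  have \<Phi>\<phi>: "apply_bcontfun (\<Phi> T) = \<phi> T" for T
    unfolding \<Phi>_def by (rule apply_Bcontfun_nat[OF \<phi>b])
  have \<Phi>: "bounded_linear \<Phi>"
  proof (rule bounded_linear_intro)
    show "norm (\<Phi> T) \<le> norm T * M" for T
      unfolding \<Phi>_def using norm_Bcontfun_nat_le[OF \<phi>b] by (simp add: mult.commute)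
  qed (auto intro!: bcontfun_eqI simp: \<Phi>\<phi> \<phi>_def blinfun.add_left blinfun.add_right sum.distrib
      blinfun.scaleR_left blinfun.scaleR_right sum_distrib_left)
  have inv: "\<Phi> (S a) = a" for a
  proof (rule bcontfun_eqI)
    fix k
    have "\<phi> (S a) k = (\<Sum>i<n k. apply_bcontfun a k * norm (x k i))"
      unfolding \<phi>_def by (intro sum.cong) (auto simp: Sv \<psi>J Dq q_def z)
    then show "apply_bcontfun (\<Phi> (S a)) k = apply_bcontfun a k"
      by (simp add: \<Phi>\<phi> x1 flip: sum_distrib_left)
  qed
  have SK: "S a \<in> compact_operators" if a: "a \<in> c_zero" for a
  proof -
    define c where "c t = (let (k, i) = prod_decode t in if i < n k then \<bar>apply_bcontfun a k\<bar> else 0)" for t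
    have "c \<longlonglongrightarrow> 0"
      using block_sequence_tendsto_zero[of "apply_bcontfun a" n] a unfolding c_def c_zero_def by simp
    then have "compact {s :: nat \<Rightarrow>\<^sub>C real. \<forall>t. \<bar>apply_bcontfun s t\<bar> \<le> c t}" by (rule compact_null_box)
    then have cpt: "compact (J ` {s. \<forall>t. \<bar>apply_bcontfun s t\<bar> \<le> c t})" (is "compact ?C")
      by (rule compact_continuous_image[OF linear_continuous_on[OF J]])
    have "blinfun_apply (S a) ` cball 0 1 \<subseteq> ?C"
    proof (intro image_subsetI)
      fix v :: 'a assume v: "v \<in> cball 0 1"
      have "\<bar>q a v t\<bar> \<le> c t" for t
      proof -
        have "\<bar>apply_bcontfun a k\<bar> * \<bar>blinfun_apply (z k i) v\<bar> \<le> \<bar>apply_bcontfun a k\<bar> * 1" for k i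
          using order_trans[OF zv[of k i v], of 1] v by (intro mult_left_mono) auto
        then show ?thesis by (auto simp: q_def c_def abs_mult split: prod.split)
      qed
      then show "blinfun_apply (S a) v \<in> ?C" unfolding Sv by (intro imageI) (simp add: Dq)
    qed
    then have "closure (blinfun_apply (S a) ` cball 0 1) \<subseteq> ?C"
      using cpt by (intro closure_minimal compact_imp_closed)
    then have "closure (blinfun_apply (S a) ` cball 0 1) = closure (blinfun_apply (S a) ` cball 0 1) \<inter> ?C" by blast
    then show ?thesis
      unfolding compact_operators_def using closed_Int_compact[OF closed_closure cpt] by (metis (mono_tags) mem_Collect_eq)
  qed
  have \<Phi>K: "\<Phi> T \<in> c_zero" if T: "T \<in> compact_operators" for T
  proof -
    have "\<phi> T \<longlonglongrightarrow> 0"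
      unfolding \<phi>_def by (rule compact_operator_pairing_tendsto_zero[OF T \<psi> x1 x2])
    then show ?thesis by (simp add: c_zero_def \<Phi>\<phi>)
  qed
  show ?thesis
    by (rule contains_complemented_c_zeroI[OF S \<Phi> inv]) (use SK \<Phi>K in auto)
qed

end
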